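(* The algebra $D_q(\mathfrak{sl}_2)$ has no (nonzero) finite-dimensional representations.
   Context: Let $k=\mathbb{C}(q)$, with $q$ generic (an indeterminate). $D_q(\mathfrak{sl}_2)$, the braided Heisenberg double of $U_q(\mathfrak{n}_+)$ for $\mathfrak{sl}_2$, is the $k$-algebra generated by $E,F,K,K^{-1}$ with relations $KK^{-1}=K^{-1}K=1$, $KE=q^{2}EK$, $KF=q^{-2}FK$ and $$EF-FE=\frac{K^{-1}}{q^{-1}-q}.$$ *)

theory Defs
  imports
    "HOL-Library.Poly_Mapping"
    "HOL-Computational_Algebra.Polynomial"
    "HOL-Computational_Algebra.Fraction_Field"
begin

subsection \<open>The ground field of rational functions in an indeterminate\<close>

type_synonym ratfun = "complex poly fract"

definition q :: ratfun where
  "q = Fract [:0, 1:] 1"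


subsection \<open>Free algebras and two-sided ideals\<close>

datatype 'g word = Word "'g list"

text \<open>
  Concatenation is written additively, because the convolution product on
  \<open>'m \<Rightarrow>\<^sub>0 'k\<close> asks for an (in general non-commutative) additive monoid of exponents.
\<close>

instantiation word :: (type) monoid_add
begin

definition zero_word :: "'a word" where
  "zero_word = Word []"

fun plus_word :: "'a word \<Rightarrow> 'a word \<Rightarrow> 'a word" where
  "Word u + Word v = Word (u @ v)"

instance
proof
  fix a b c :: "'a word"
  show "a + b + c = a + (b + c)" by (cases a; cases b; cases c) simp
  show "0 + a = a" by (cases a) (simp add: zero_word_def)
  show "a + 0 = a" by (cases a) (simp add: zero_word_def)
qed

end

type_synonym ('g, 'k) free_algebra = "'g word \<Rightarrow>\<^sub>0 'k"

abbreviation free_gen :: "'g \<Rightarrow> ('g, 'k::comm_ring_1) free_algebra" where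
  "free_gen g \<equiv> Poly_Mapping.single (Word [g]) 1"

abbreviation free_const :: "'k \<Rightarrow> ('g, 'k::comm_ring_1) free_algebra" where
  "free_const c \<equiv> Poly_Mapping.single 0 c"

inductive_set two_sided_ideal :: "'a::ring_1 set \<Rightarrow> 'a set" for R :: "'a set" where
  generator: "r \<in> R \<Longrightarrow> r \<in> two_sided_ideal R"
| zero: "0 \<in> two_sided_ideal R"
| add: "x \<in> two_sided_ideal R \<Longrightarrow> y \<in> two_sided_ideal R \<Longrightarrow> x + y \<in> two_sided_ideal R"
| mult_left: "x \<in> two_sided_ideal R \<Longrightarrow> a * x \<in> two_sided_ideal R"
| mult_right: "x \<in> two_sided_ideal R \<Longrightarrow> x * a \<in> two_sided_ideal R"

lemma two_sided_ideal_uminus: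
  "x \<in> two_sided_ideal R \<Longrightarrow> - x \<in> two_sided_ideal R"
  using two_sided_ideal.mult_left[of x R "- 1"] by simp

lemma two_sided_ideal_diff_add:
  assumes "a - a' \<in> two_sided_ideal R" "b - b' \<in> two_sided_ideal R"
  shows "(a + b) - (a' + b') \<in> two_sided_ideal R"
  using two_sided_ideal.add[OF assms] by (simp add: algebra_simps)

lemma two_sided_ideal_diff_mult:
  assumes "a - a' \<in> two_sided_ideal R" "b - b' \<in> two_sided_ideal R"
  shows "a * b - a' * b' \<in> two_sided_ideal R"
proof -
  have "a * b - a' * b' = (a - a') * b + a' * (b - b')"
    by (simp add: algebra_simps)
  then show ?thesis
    using assms by (auto intro: two_sided_ideal.intros)
qed


subsection \<open>The algebra $D_q(\mathfrak{sl}_2)$ by generators and relations\<close>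

datatype gen = GE | GF | GK | GKinv

definition Dq_relators :: "(gen, ratfun) free_algebra set" where
  "Dq_relators =
    (let E = free_gen GE; F = free_gen GF; K = free_gen GK; Kinv = free_gen GKinv in
     {K * Kinv - 1,
      Kinv * K - 1,
      K * E - free_const (q ^ 2) * E * K,
      K * F - free_const (inverse q ^ 2) * F * K,
      E * F - F * E - free_const (inverse (inverse q - q)) * Kinv})"

definition Dq_rel :: "(gen, ratfun) free_algebra \<Rightarrow> (gen, ratfun) free_algebra \<Rightarrow> bool" where
  "Dq_rel x y \<longleftrightarrow> x - y \<in> two_sided_ideal Dq_relators"

quotient_type Dq = "(gen, ratfun) free_algebra" / Dq_rel
proof (rule equivpI)
  show "reflp Dq_rel"
    by (rule reflpI) (simp add: Dq_rel_def two_sided_ideal.zero)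
  show "symp Dq_rel"
  proof (rule sympI)
    fix x y
    assume "Dq_rel x y"
    then show "Dq_rel y x"
      using two_sided_ideal_uminus[of "x - y" Dq_relators] by (simp add: Dq_rel_def)
  qed
  show "transp Dq_rel"
  proof (rule transpI)
    fix x y z
    assume "Dq_rel x y" "Dq_rel y z"
    then show "Dq_rel x z"
      using two_sided_ideal.add[of "x - y" Dq_relators "y - z"] by (simp add: Dq_rel_def)
  qed
qed

text \<open>
  The class \<open>ring_1\<close> would in addition require \<open>0 \<noteq> 1\<close>, which is a theorem about this
  presentation and not part of the construction.
\<close>

instantiation Dq :: "{ring, monoid_mult}"
begin

lift_definition zero_Dq :: Dq is 0 .

lift_definition one_Dq :: Dq is 1 .

lift_definition plus_Dq :: "Dq \<Rightarrow> Dq \<Rightarrow> Dq" is "(+)"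
  by (simp add: Dq_rel_def two_sided_ideal_diff_add)

lift_definition uminus_Dq :: "Dq \<Rightarrow> Dq" is uminus
  unfolding Dq_rel_def
  using two_sided_ideal_uminus by (metis minus_diff_minus)

lift_definition minus_Dq :: "Dq \<Rightarrow> Dq \<Rightarrow> Dq" is "(-)"
proof -
  fix a a' b b'
  assume "Dq_rel a a'" "Dq_rel b b'"
  moreover have "a - b - (a' - b') = (a - a') + - (b - b')"
    by simp
  ultimately show "Dq_rel (a - b) (a' - b')"
    unfolding Dq_rel_def by (metis two_sided_ideal.add two_sided_ideal_uminus)
qed

lift_definition times_Dq :: "Dq \<Rightarrow> Dq \<Rightarrow> Dq" is "(*)"
  by (simp add: Dq_rel_def two_sided_ideal_diff_mult)

instance
  by standard
    (transfer, simp add: Dq_rel_def algebra_simps two_sided_ideal.zero)+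

end

context
  fixes c :: ratfun
begin

lift_definition Dq_scale :: "Dq \<Rightarrow> Dq" is "\<lambda>x. free_const c * x"
  by (simp add: Dq_rel_def two_sided_ideal.mult_left flip: right_diff_distrib)

end

lift_definition Dq_E :: Dq is "free_gen GE" .
lift_definition Dq_F :: Dq is "free_gen GF" .
lift_definition Dq_K :: Dq is "free_gen GK" .
lift_definition Dq_Kinv :: Dq is "free_gen GKinv" .

lemma abs_Dq_eqI: "x - y \<in> two_sided_ideal Dq_relators \<Longrightarrow> abs_Dq x = abs_Dq y"
  by (simp add: Dq.abs_eq_iff Dq_rel_def)

lemmas Dq_abs_eqs =
  Dq_E_def Dq_F_def Dq_K_def Dq_Kinv_def one_Dq_def times_Dq.abs_eq minus_Dq.abs_eq
  plus_Dq.abs_eq Dq_scale.abs_eq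

lemma Dq_relations:
  "Dq_K * Dq_Kinv = 1"
  "Dq_Kinv * Dq_K = 1"
  "Dq_K * Dq_E = Dq_scale (q ^ 2) (Dq_E * Dq_K)"
  "Dq_K * Dq_F = Dq_scale (inverse q ^ 2) (Dq_F * Dq_K)"
  "Dq_E * Dq_F - Dq_F * Dq_E = Dq_scale (inverse (inverse q - q)) Dq_Kinv"
  unfolding Dq_abs_eqs
  by (rule abs_Dq_eqI; rule two_sided_ideal.generator;
      simp add: Dq_relators_def Let_def mult.assoc)+

lemma vector_space_Dq_scale: "vector_space Dq_scale"
proof
  fix a b :: ratfun and x y :: Dq
  obtain x' y' where [simp]: "x = abs_Dq x'" "y = abs_Dq y'"
    by (induct x rule: Dq.abs_induct, induct y rule: Dq.abs_induct) blast
  show "Dq_scale a (x + y) = Dq_scale a x + Dq_scale a y"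
    by (simp add: Dq_abs_eqs distrib_left)
  show "Dq_scale (a + b) x = Dq_scale a x + Dq_scale b x"
    by (simp add: Dq_abs_eqs single_add distrib_right)
  show "Dq_scale a (Dq_scale b x) = Dq_scale (a * b) x"
    by (simp add: Dq_abs_eqs mult_single flip: mult.assoc)
  show "Dq_scale 1 x = x"
    by (simp add: Dq_abs_eqs)
qed


subsection \<open>Representations\<close>

locale Dq_representation = vector_space scale
  for scale :: "ratfun \<Rightarrow> 'v::ab_group_add \<Rightarrow> 'v" +
  fixes rho :: "Dq \<Rightarrow> 'v \<Rightarrow> 'v"
  assumes linear_rho: "Vector_Spaces.linear scale scale (rho a)"
    and rho_add: "rho (a + b) v = rho a v + rho b v"
    and rho_scale: "rho (Dq_scale c a) v = scale c (rho a v)"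
    and rho_mult: "rho (a * b) v = rho a (rho b v)"
    and rho_one: "rho 1 v = v"

end

theory Submission imports Defs begin

text \<open>
  The representation is trivial because \<open>E\<close> acts nilpotently, while the commutator relation
  lowers any exponent that annihilates the representation.

  \<^item> Write \<open>t = q\<^sup>2\<close> and let \<open>L\<close> be the (injective) action of \<open>K\<inverse>\<close>, so that \<open>E L = t L E\<close>. In finite
  dimension some nonzero polynomial annihilates \<open>E\<close>; take \<open>p\<close> of least degree \<open>d\<close>. Moving \<open>L\<close>
  through \<open>p(E)\<close> shows that \<open>p(t x)\<close> annihilates \<open>E\<close> too, so \<open>p(t x) - t\<^sup>d p(x)\<close>, which has no term
  in degree \<open>d\<close>, must be zero. As \<open>t\<close> is not a root of unity, \<open>p\<close> is a multiple of \<open>x\<^sup>d\<close>, that is,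
  \<open>E\<^sup>d = 0\<close> (lemma \<open>nilpotent_if_skew_commutes\<close>). The usual argument is that
  \<open>E\<close> moves eigenvectors of \<open>K\<close> to new eigenvalues; but the ground field is not algebraically
  closed, so \<open>K\<close> may have no eigenvalue in it, and polynomials in \<open>E\<close> take the place of eigenvectors.

  \<^item> From \<open>E F - F E = c L\<close> one gets
  \<open>E\<^sup>n F - F E\<^sup>n = c (1 + t + \<dots> + t\<^sup>n\<^sup>-\<^sup>1) L E\<^sup>n\<^sup>-\<^sup>1\<close> (lemma \<open>commutator_funpow\<close>). For \<open>n > 0\<close> the scalar
  is nonzero and \<open>L\<close> is injective, so \<open>E\<^sup>n = 0\<close> implies \<open>E\<^sup>n\<^sup>-\<^sup>1 = 0\<close>. Descending to \<open>n = 0\<close>, the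
  identity map is zero. The contrast with \<open>U\<^sub>q(sl\<^sub>2)\<close> is that there the commutator is a multiple of the
  difference \<open>K - K\<inverse>\<close>, and the corresponding scalar may vanish on a highest weight vector.
\<close>

section \<open>Polynomials in an endomorphism\<close>

locale endomorphism = vector_space scale
  for scale :: "'a::field \<Rightarrow> 'b::ab_group_add \<Rightarrow> 'b" +
  fixes T :: "'b \<Rightarrow> 'b"
  assumes linear_T: "Vector_Spaces.linear scale scale T"
begin

sublocale T: Vector_Spaces.linear scale scale T
  by (rule linear_T)

definition poly_op :: "'a poly \<Rightarrow> 'b \<Rightarrow> 'b" where
  "poly_op p v = (\<Sum>i\<le>degree p. scale (coeff p i) ((T ^^ i) v))"

lemma poly_op_eq_sum:
  assumes "degree p \<le> n"
  shows "poly_op p v = (\<Sum>i\<le>n. scale (coeff p i) ((T ^^ i) v))"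
  unfolding poly_op_def using assms
  by (intro sum.mono_neutral_left) (auto simp: coeff_eq_0)

lemma poly_op_0 [simp]: "poly_op 0 v = 0"
  by (simp add: poly_op_def)

lemma poly_op_add: "poly_op (p + r) v = poly_op p v + poly_op r v"
proof -
  define n where "n = max (degree p) (degree r)"
  have "degree p \<le> n" "degree r \<le> n" "degree (p + r) \<le> n"
    by (auto simp: n_def degree_add_le_max)
  then show ?thesis
    by (simp add: poly_op_eq_sum[of _ n] scale_left_distrib sum.distrib)
qed

lemma poly_op_smult: "poly_op (smult a p) v = scale a (poly_op p v)"
  by (simp add: poly_op_eq_sum[of "smult a p" "degree p"] poly_op_def degree_smult_le scale_sum_right)

lemma poly_op_diff: "poly_op (p - r) v = poly_op p v - poly_op r v"
  using poly_op_add[of "p - r" r v] by simp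

lemma poly_op_monom: "poly_op (monom a n) v = scale a ((T ^^ n) v)"
proof -
  have "poly_op (monom a n) v = (\<Sum>i\<le>n. scale (coeff (monom a n) i) ((T ^^ i) v))"
    by (rule poly_op_eq_sum) (rule degree_monom_le)
  also have "\<dots> = (\<Sum>i\<le>n. if i = n then scale a ((T ^^ i) v) else 0)"
    by (intro sum.cong) auto
  finally show ?thesis by simp
qed

lemma poly_op_sum: "finite A \<Longrightarrow> poly_op (\<Sum>i\<in>A. f i) v = (\<Sum>i\<in>A. poly_op (f i) v)"
  by (induction A rule: finite_induct) (simp_all add: poly_op_add)

lemma poly_op_pCons: "poly_op (pCons a p) v = scale a v + T (poly_op p v)"
proof -
  have "poly_op (pCons a p) v
      = (\<Sum>i\<le>Suc (degree p). scale (coeff (pCons a p) i) ((T ^^ i) v))"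
    by (rule poly_op_eq_sum) (rule degree_pCons_le)
  also have "\<dots> = scale a v + T (poly_op p v)"
    by (simp only: sum.atMost_Suc_shift) (simp add: poly_op_def T.sum T.scale)
  finally show ?thesis .
qed

lemma poly_op_mult: "poly_op (p * r) v = poly_op p (poly_op r v)"
  by (induction p)
    (simp_all add: poly_op_add poly_op_smult poly_op_pCons)

lemma poly_op_zero_vector: "poly_op p 0 = 0"
  by (induction p) (simp_all add: poly_op_pCons)

lemma linear_poly_op: "Vector_Spaces.linear scale scale (poly_op p)"
proof -
  have "poly_op p (v + w) = poly_op p v + poly_op p w" for v w
    by (induction p) (simp_all add: poly_op_pCons T.add scale_right_distrib)
  moreover have "poly_op p (scale a v) = scale a (poly_op p v)" for a v
    by (induction p)
      (simp_all add: poly_op_pCons T.scale scale_right_distrib mult.commute)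
  ultimately show ?thesis
    by (unfold_locales) auto
qed

section \<open>Endomorphisms that commute up to a scalar\<close>

lemma funpow_skew_commutes:
  assumes skew: "\<And>v. T (L v) = scale t (L (T v))"
  shows "(T ^^ i) (L v) = scale (t ^ i) (L ((T ^^ i) v))"
  by (induction i) (simp_all add: T.scale skew mult.commute)

text \<open>
  Each power of \<open>T\<close> that is moved past \<open>F\<close> leaves one copy of \<open>L\<close> behind; collecting these copies
  on the left produces the powers of \<open>t\<close>, hence the geometric sum.
\<close>

lemma commutator_funpow:
  assumes skew: "\<And>v. T (L v) = scale t (L (T v))"
    and comm: "\<And>v. T (F v) - F (T v) = scale c (L v)"
  shows "(T ^^ Suc n) (F v) - F ((T ^^ Suc n) v) = scale (c * (\<Sum>i\<le>n. t ^ i)) (L ((T ^^ n) v))"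
proof (induction n)
  case 0
  then show ?case by (simp add: comm)
next
  case (Suc n)
  let ?w = "(T ^^ Suc n) v"
  have "(T ^^ Suc (Suc n)) (F v) - F ((T ^^ Suc (Suc n)) v)
      = T ((T ^^ Suc n) (F v) - F ?w) + (T (F ?w) - F (T ?w))"
    by (simp add: T.diff)
  also have "\<dots> = scale (c * (\<Sum>i\<le>n. t ^ i) * t + c) (L ?w)"
    by (simp only: Suc.IH comm T.scale skew scale_left_distrib) simp
  also have "c * (\<Sum>i\<le>n. t ^ i) * t + c = c * (\<Sum>i\<le>Suc n. t ^ i)"
    by (simp only: sum.atMost_Suc_shift) (simp add: algebra_simps sum_distrib_left)
  finally show ?case .
qed

end

section \<open>Annihilating polynomials in finite dimension\<close>

locale finite_dimensional_endomorphism =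
  endomorphism scale T + finite_dimensional_vector_space scale Basis
  for scale :: "'a::field \<Rightarrow> 'b::ab_group_add \<Rightarrow> 'b" and T Basis
begin

lemma ex_poly_op_annihilates_vector: "\<exists>p. p \<noteq> 0 \<and> poly_op p v = 0"
proof (cases "inj (\<lambda>i. (T ^^ i) v)")
  case False
  then obtain i j where ij: "i \<noteq> j" "(T ^^ i) v = (T ^^ j) v"
    by (auto simp: inj_on_def)
  then have "coeff (monom 1 i - monom 1 j :: 'a poly) i \<noteq> 0" by simp
  then have "monom 1 i - monom 1 j \<noteq> (0 :: 'a poly)" by (metis coeff_0)
  with ij show ?thesis
    by (intro exI[of _ "monom 1 i - monom 1 j"]) (simp add: poly_op_diff poly_op_monom)
next
  case True
  let ?f = "\<lambda>i. (T ^^ i) v"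
  have "infinite (range ?f)" using True by (simp add: finite_image_iff)
  then have "dependent (range ?f)" using finiteI_independent by blast
  then obtain S u where S: "finite S" "S \<subseteq> range ?f" "(\<Sum>w\<in>S. scale (u w) w) = 0" "\<exists>w\<in>S. u w \<noteq> 0"
    by (auto simp: dependent_explicit)
  from S(2) obtain I where I: "S = ?f ` I" by (meson subset_image_iff)
  have inj: "inj_on ?f I" using True by (rule inj_on_subset) simp
  have fin: "finite I" using S(1) I inj by (simp add: finite_image_iff)
  define p where "p = (\<Sum>i\<in>I. monom (u (?f i)) i)"
  have "poly_op p v = (\<Sum>i\<in>I. scale (u (?f i)) (?f i))"
    by (simp add: p_def poly_op_sum fin poly_op_monom)
  also have "\<dots> = 0" using S(3) by (simp add: I sum.reindex inj)
  finally have "poly_op p v = 0" .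
  moreover obtain i where i: "i \<in> I" "u (?f i) \<noteq> 0" using S(4) I by auto
  have "coeff p i = u (?f i)"
    using i fin by (simp add: p_def coeff_sum)
  with i have "p \<noteq> 0" by auto
  ultimately show ?thesis by blast
qed

text \<open>
  Polynomials in \<open>T\<close> commute with each other, so a product of polynomials annihilates every vector
  that one of the factors annihilates.
\<close>

lemma ex_poly_op_annihilates_finite:
  assumes "finite S"
  shows "\<exists>p. p \<noteq> 0 \<and> (\<forall>v\<in>S. poly_op p v = 0)"
  using \<open>finite S\<close>
proof (induction S rule: finite_induct)
  case empty
  show ?case by (intro exI[of _ 1]) simp
next
  case (insert w S)
  then obtain p where p: "p \<noteq> 0" "\<forall>v\<in>S. poly_op p v = 0" by blast
  obtain r where r: "r \<noteq> 0" "poly_op r w = 0"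
    using ex_poly_op_annihilates_vector by blast
  have "poly_op (p * r) w = 0"
    by (simp add: poly_op_mult r poly_op_zero_vector)
  moreover have "poly_op (p * r) v = 0" if "v \<in> S" for v
    using that p by (simp add: mult.commute[of p] poly_op_mult poly_op_zero_vector)
  ultimately show ?case
    using p r by (intro exI[of _ "p * r"]) auto
qed

lemma ex_annihilating_poly: "\<exists>p. p \<noteq> 0 \<and> (\<forall>v. poly_op p v = 0)"
proof -
  obtain p where p: "p \<noteq> 0" "\<forall>v\<in>Basis. poly_op p v = 0"
    using ex_poly_op_annihilates_finite[OF finite_Basis] by blast
  interpret P: Vector_Spaces.linear scale scale "poly_op p"
    by (rule linear_poly_op)
  have "poly_op p v = 0" for v
    using P.eq_0_on_span[of Basis v] p span_Basis by auto
  with p show ?thesis by blast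
qed

section \<open>Nilpotency and the vanishing of the space\<close>

text \<open>
  A minimal annihilating polynomial is unchanged, up to a factor, by the substitution \<open>x \<mapsto> t x\<close>
  that comes from moving \<open>L\<close> through it. Since the powers of \<open>t\<close> are pairwise different, only a
  single monomial has this property.
\<close>

lemma nilpotent_if_skew_commutes:
  assumes L: "Vector_Spaces.linear scale scale L" and inj: "inj L"
    and skew: "\<And>v. T (L v) = scale t (L (T v))"
    and t: "inj (\<lambda>i::nat. t ^ i)"
  shows "\<exists>n. \<forall>v. (T ^^ n) v = 0"
proof -
  interpret L: Vector_Spaces.linear scale scale L by fact
  define annihilates where "annihilates p \<longleftrightarrow> (\<forall>v. poly_op p v = 0)" for p
  obtain p where p: "p \<noteq> 0" "annihilates p"
    and least: "\<And>r. r \<noteq> 0 \<Longrightarrow> annihilates r \<Longrightarrow> degree p \<le> degree r"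
    using ex_annihilating_poly
      ex_has_least_nat[of "\<lambda>p. p \<noteq> 0 \<and> annihilates p" _ degree]
    unfolding annihilates_def by metis
  define d where "d = degree p"
  \<comment> \<open>\<open>pt\<close> is \<open>p(t x)\<close>.\<close>
  define pt where "pt = (\<Sum>i\<le>d. monom (coeff p i * t ^ i) i)"
  have coeff_pt: "coeff pt i = coeff p i * t ^ i" for i
    by (auto simp: pt_def coeff_sum d_def coeff_eq_0)
  have "poly_op p (L v) = L (poly_op pt v)" for v
    by (simp add: pt_def poly_op_sum poly_op_monom L.sum L.scale)
      (simp add: poly_op_def funpow_skew_commutes[of L t, OF skew] d_def)
  with p(2) have "L (poly_op pt v) = L 0" for v
    by (simp add: annihilates_def L.zero)
  then have pt: "poly_op pt v = 0" for v using inj by (meson injD)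
  define r where "r = pt - smult (t ^ d) p"
  have coeff_r: "coeff r i = coeff p i * (t ^ i - t ^ d)" for i
    by (simp add: r_def coeff_pt algebra_simps)
  have "annihilates r"
    using pt p(2) by (simp add: annihilates_def r_def poly_op_diff poly_op_smult)
  moreover have "degree r < d" if "r \<noteq> 0"
  proof -
    have "degree r \<le> d"
      by (rule degree_le) (auto simp: coeff_r d_def coeff_eq_0)
    moreover have "coeff r d = 0" by (simp add: coeff_r)
    ultimately show ?thesis using that by (metis leading_coeff_0_iff le_neq_implies_less)
  qed
  ultimately have "r = 0" using least unfolding d_def by fastforce
  then have "coeff p i * (t ^ i - t ^ d) = 0" for i by (metis coeff_r coeff_0)
  then have "coeff p i = 0" if "i \<noteq> d" for i using that t by (auto dest: injD)
  then have "p = monom (coeff p d) d" by (intro poly_eqI) auto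
  moreover have "coeff p d \<noteq> 0" using p(1) by (simp add: d_def)
  ultimately have "(T ^^ d) v = 0" for v
    using p(2) poly_op_monom[of "coeff p d" d v]
    by (simp add: annihilates_def scale_eq_0_iff)
  then show ?thesis by blast
qed

text \<open>
  An exponent \<open>n + 1\<close> with \<open>T\<^sup>n\<^sup>+\<^sup>1 = 0\<close> can be lowered to \<open>n\<close>: the commutator of \<open>T\<^sup>n\<^sup>+\<^sup>1\<close> with \<open>F\<close>
  vanishes, and it is a nonzero multiple of \<open>L T\<^sup>n\<close>, because the geometric sum is
  \<open>(t\<^sup>n\<^sup>+\<^sup>1 - 1) / (t - 1)\<close> and \<open>t\<close> is not a root of unity.
\<close>

lemma trivial_if_commutator_skew:
  fixes v :: 'b
  assumes F: "Vector_Spaces.linear scale scale F"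
    and L: "Vector_Spaces.linear scale scale L" and inj: "inj L"
    and skew: "\<And>v. T (L v) = scale t (L (T v))"
    and comm: "\<And>v. T (F v) - F (T v) = scale c (L v)"
    and t: "inj (\<lambda>i::nat. t ^ i)" and c: "c \<noteq> 0"
  shows "v = 0"
proof -
  interpret F: Vector_Spaces.linear scale scale F by fact
  interpret L: Vector_Spaces.linear scale scale L by fact
  have geometric: "(\<Sum>i\<le>n. t ^ i) \<noteq> 0" for n
  proof
    assume "(\<Sum>i\<le>n. t ^ i) = 0"
    then have "t ^ Suc n = t ^ 0"
      using sum_gp_basic[of t n] by simp
    with t have "Suc n = 0" by (rule injD)
    then show False by simp
  qed
  have "v = 0" if "\<forall>v. (T ^^ n) v = 0" for n
    using that
  proof (induction n)
    case 0
    then show ?case by simp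
  next
    case (Suc n)
    have "L ((T ^^ n) v) = L 0" for v
      using commutator_funpow[of L t F c n v, OF skew comm] Suc.prems geometric[of n] c
      by (simp add: F.zero L.zero)
    then have "\<forall>v. (T ^^ n) v = 0" using inj by (meson injD)
    then show ?case by (rule Suc.IH)
  qed
  then show ?thesis
    using nilpotent_if_skew_commutes[of L t, OF L inj skew t] by blast
qed

end

section \<open>Representations of the braided Heisenberg double\<close>

lemma q_power: "q ^ n = Fract (monom 1 n) 1"
  by (induction n) (simp_all add: q_def One_fract_def monom_Suc monom_0 pCons_one)

lemma inj_q_power: "inj (\<lambda>n::nat. q ^ n)"
proof (rule injI)
  fix m n :: nat
  assume "q ^ m = q ^ n"
  then have "monom (1::complex) m = monom 1 n" by (simp add: q_power eq_fract)
  then show "m = n" by (metis degree_monom_eq one_neq_zero)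
qed

theorem corollary3p9p4:
  fixes scale :: "ratfun \<Rightarrow> 'v::ab_group_add \<Rightarrow> 'v"
    and Basis :: "'v set"
    and rho :: "Dq \<Rightarrow> 'v \<Rightarrow> 'v"
  assumes "finite_dimensional_vector_space scale Basis"
    and "Dq_representation scale rho"
  shows "(UNIV :: 'v set) = {0}"
proof -
  interpret finite_dimensional_vector_space scale Basis by fact
  interpret R: Dq_representation scale rho by fact
  let ?E = "rho Dq_E" and ?F = "rho Dq_F" and ?K = "rho Dq_K" and ?L = "rho Dq_Kinv"
  let ?c = "inverse (inverse q - q)"
  interpret E: finite_dimensional_endomorphism scale ?E Basis
    by (intro finite_dimensional_endomorphism.intro endomorphism.intro
        endomorphism_axioms.intro R.linear_rho) unfold_locales
  interpret L: Vector_Spaces.linear scale scale ?L by (rule R.linear_rho)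
  have KL: "?K (?L v) = v" and LK: "?L (?K v) = v" for v
    by (simp_all add: Dq_relations R.rho_one flip: R.rho_mult)
  have "inj ?L" using KL by (metis injI)
  moreover have "?E (?L v) = scale (q ^ 2) (?L (?E v))" for v
  proof -
    have "?K (?E w) = scale (q ^ 2) (?E (?K w))" for w
      by (simp add: Dq_relations R.rho_scale flip: R.rho_mult)
    then have "?L (?K (?E (?L v))) = ?L (scale (q ^ 2) (?E (?K (?L v))))" by simp
    then show ?thesis by (simp add: LK KL L.scale)
  qed
  moreover have "?E (?F v) - ?F (?E v) = scale ?c (?L v)" for v
  proof -
    have "?E (?F v) = rho ((Dq_E * Dq_F - Dq_F * Dq_E) + Dq_F * Dq_E) v"
      by (simp add: R.rho_mult)
    also have "\<dots> = scale ?c (?L v) + ?F (?E v)"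
      by (simp only: R.rho_add Dq_relations R.rho_scale R.rho_mult)
    finally show ?thesis by simp
  qed
  moreover have "inj (\<lambda>i::nat. (q ^ 2) ^ i)"
  proof (rule injI)
    fix i j :: nat
    assume "(q ^ 2) ^ i = (q ^ 2) ^ j"
    then have "2 * i = 2 * j" using inj_q_power by (simp only: flip: power_mult) (drule injD, assumption+)
    then show "i = j" by simp
  qed
  moreover have "?c \<noteq> 0"
  proof
    assume "?c = 0"
    then have "inverse q = q" by simp
    \<comment> \<open>As \<open>inverse 0 = 0\<close>, this does not yet give \<open>q\<^sup>2 = 1\<close>; the cubed form holds for \<open>q = 0\<close> too.\<close>
    then have "q ^ 3 = q ^ 1" by (cases "q = 0") (auto simp: power3_eq_cube field_simps)
    then have "(3::nat) = 1" using inj_q_power by (meson injD)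
    then show False by simp
  qed
  ultimately have "v = 0" for v :: 'v
    by (rule E.trivial_if_commutator_skew[OF R.linear_rho R.linear_rho])
  then show ?thesis by auto
qed

end
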